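(* Assume $n>2$ is a natural number. Let $PIV^W=(p_1^W,\dots,p_n^W)$ and $PIV^B=(p_1^B,\dots,p_n^B)$ denote the probability index vectors of the Weibull method and the Beta Median method respectively, that is, $p_i^W=\frac{i}{n+1}$ and $p_i^B=\mathrm{Med}\{\mathrm{Beta}(i,n+1-i)\}$ for $i=1,\dots,n$. Then the following results hold. (a) $0<p_i^W-p_i^B<|n+1-2i|/(n^2-1)$, $i=1,\dots,[n/2]$. (b) $0<p_i^B-p_i^W<|n+1-2i|/(n^2-1)$, $i=[n/2]+1,\dots,n$. (c) $p_i^W=p_i^B$, $i=(n+1)/2$, if $n$ is odd. (d) $|p_i^W-p_i^B|<1/(n+1)$, $i=1,\dots,n$. (e) $0<p_1^B<p_1^W<1$ and $0<p_n^W<p_n^B<1$. (f) $p_{i-1}^W<p_i^B<p_i^W$, $i=2,\dots,[n/2]$. (g) $p_{i-1}^B<p_i^W<p_i^B$, $i=[n/2]+1,\dots,n-1$. (h) $\left|\frac{p_i^B}{p_i^W}-1\right|<\frac{|n+1-2i|}{i(n-1)}<\frac{1}{i}$, $i=1,\dots,n$. (i) $\left|\frac{1-p_i^B}{1-p_i^W}-1\right|<\frac{|n+1-2i|}{(n+1-i)(n-1)}<\frac{1}{n+1-i}$, $i=1,\dots,n$. (j) $\displaystyle\lim_{n\to\infty}\frac{p_1^B}{p_1^W}=\lim_{n\to\infty}\frac{1-p_n^B}{1-p_n^W}=\log(2)$.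
   Context: $\mathrm{Beta}(\alpha,\beta)$ is the distribution on $[0,1]$ with density $\frac{\Gamma(\alpha+\beta)}{\Gamma(\alpha)\Gamma(\beta)}x^{\alpha-1}(1-x)^{\beta-1}$, and $\mathrm{Med}$ denotes its median. A probability index vector (PIV) is a vector of probabilities $0<p_1\le p_2\le\dots\le p_n<1$ used as plotting positions for the order statistics of a sample of size $n$ in a QQ-plot. The entries $p_i^W$ and $p_i^B$ depend on $n$. $[m]$ denotes the largest integer less than or equal to $m$, and $\log$ is the natural logarithm.
   Formalization: At i=(n+1)/2 (n odd), where p_i^W=p_i^B, the strict bounds in (b), p_i^W<p_i^B in (g), and the first inequality of (h),(i) are false and are dropped (weak form kept in (g)-(i)); at i=1,n the second inequality of (h),(i) is an equality, stated as ≤. *)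

theory Defs
  imports "HOL-Probability.Probability"
begin

definition beta_density :: "real \<Rightarrow> real \<Rightarrow> real \<Rightarrow> real" where
  "beta_density a b x =
     Gamma (a + b) / (Gamma a * Gamma b) * x powr (a - 1) * (1 - x) powr (b - 1)
       * indicator {0..1} x"

text \<open>
  Since \<open>0 powr c = 0\<close> for every \<open>c\<close>, the density may differ from the usual one at the
  endpoints \<open>0\<close> and \<open>1\<close>; this does not affect the measure.
\<close>

definition beta_distr :: "real \<Rightarrow> real \<Rightarrow> real measure" where
  "beta_distr a b = density lborel (\<lambda>x. ennreal (beta_density a b x))"

definition is_median :: "real measure \<Rightarrow> real \<Rightarrow> bool" where
  "is_median M m \<longleftrightarrow> measure M {..m} \<ge> 1 / 2 \<and> measure M {m..} \<ge> 1 / 2"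

text \<open>
  The median is unique for the distributions used below: a beta density with positive
  parameters is positive on the open unit interval.
\<close>

definition med :: "real measure \<Rightarrow> real" where
  "med M = (THE m. is_median M m)"

text \<open>
  Probability index vectors of size \<open>n\<close>, as functions of the index; only the entries
  with \<open>1 \<le> i \<le> n\<close> are meaningful.
\<close>

definition piv_W :: "nat \<Rightarrow> nat \<Rightarrow> real" where
  "piv_W n i = real i / (real n + 1)"

definition piv_B :: "nat \<Rightarrow> nat \<Rightarrow> real" where
  "piv_B n i = med (beta_distr (real i) (real n + 1 - real i))"

end

theory Submission
  imports Defs "HOL-Real_Asymp.Real_Asymp"
begin

text \<open>
  Everything rests on the mode--median--mean inequality for a beta distribution with
  parameters \<open>1 \<le> a < b\<close>: the median lies strictly between the mode \<open>(a - 1) / (a + b - 2)\<close>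
  and the mean \<open>a / (a + b)\<close>. With \<open>a = i\<close> and \<open>b = n + 1 - i\<close> the mean is the Weibull
  position \<open>i / (n + 1)\<close>, the mode is \<open>(i - 1) / (n - 1)\<close>, and their difference is exactly
  \<open>(n + 1 - 2 * i) / (n\<^sup>2 - 1)\<close>. So for \<open>2 * i < n + 1\<close> the two positions differ by less than
  this amount, in a known direction. The symmetry \<open>x \<mapsto> 1 - x\<close>, which exchanges the two
  parameters, gives the case \<open>2 * i > n + 1\<close>, and it forces the median \<open>1/2\<close> when
  \<open>2 * i = n + 1\<close>. All the finite-sample estimates are arithmetic consequences of these bounds.
  The limits come from the explicit median \<open>1 - (1/2) powr (1/n)\<close> of the beta distribution
  with parameters \<open>1\<close> and \<open>n\<close>.

  Both halves of the inequality come from one comparison (\<open>powr_product_reflect_less\<close>): if the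
  maximum \<open>m\<close> of \<open>x powr p * (1 - x) powr q\<close> lies to the left of \<open>1/2\<close>, the function falls off
  more slowly to the right of \<open>m\<close> than to the left.

  For the mode it is applied to the density itself: reflecting \<open>{0..m}\<close> in the mode \<open>m\<close> shows
  that \<open>{m..2 * m}\<close> carries more mass than \<open>{0..m}\<close>, so \<open>{0..m}\<close> carries less than one half.

  For the mean \<open>m\<close> it is applied to \<open>G x = x powr a * (1 - x) powr b\<close>, which satisfies
  \<open>G' x = (a + b) * (m - x) * g x\<close> with \<open>g\<close> the unnormalised density, so that \<open>G\<close> has its
  maximum at the mean. Writing \<open>g x = G' x / ((a + b) * (m - x))\<close> and integrating by parts, the
  mass to the left of \<open>m\<close> minus the mass to the right becomes the integral of
  \<open>(G (m + t) - G (m - t)) / ((a + b) * t\<^sup>2)\<close> over \<open>0 < t < 1 - m\<close> (with \<open>G = 0\<close> to the left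
  of \<open>0\<close>), and this integrand is positive.
\<close>

section \<open>The incomplete beta integral\<close>

definition beta_kernel :: "real \<Rightarrow> real \<Rightarrow> real \<Rightarrow> real" where
  "beta_kernel a b x = x powr (a - 1) * (1 - x) powr (b - 1)"

definition incomplete_beta :: "real \<Rightarrow> real \<Rightarrow> real \<Rightarrow> real" where
  "incomplete_beta a b x = integral {0..x} (beta_kernel a b)"

lemma beta_kernel_nonneg [simp]: "beta_kernel a b x \<ge> 0"
  by (simp add: beta_kernel_def)

lemma beta_kernel_pos: "0 < x \<Longrightarrow> x < 1 \<Longrightarrow> beta_kernel a b x > 0"
  by (simp add: beta_kernel_def)

lemma beta_kernel_reflect: "beta_kernel b a (1 - x) = beta_kernel a b x"
  by (simp add: beta_kernel_def)

lemma beta_kernel_has_integral: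
  assumes "a > 0" "b > 0"
  shows "(beta_kernel a b has_integral Beta a b) {0..1}"
  using has_integral_Beta_real[OF assms] by (simp add: beta_kernel_def[abs_def])

lemma incomplete_beta_0 [simp]: "incomplete_beta a b 0 = 0"
  by (simp add: incomplete_beta_def)

lemma incomplete_beta_1:
  assumes "a > 0" "b > 0"
  shows "incomplete_beta a b 1 = Beta a b"
  using beta_kernel_has_integral[OF assms] by (simp add: incomplete_beta_def integral_unique)

lemma Beta_pos_real: "a > 0 \<Longrightarrow> b > 0 \<Longrightarrow> Beta a b > (0::real)"
  by (simp add: Beta_def Gamma_real_pos)

lemma beta_kernel_has_integral_interval:
  assumes "a > 0" "b > 0" "0 \<le> u" "u \<le> v" "v \<le> 1"
  shows "(beta_kernel a b has_integral incomplete_beta a b v - incomplete_beta a b u) {u..v}"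
proof -
  have int: "beta_kernel a b integrable_on {0..1}"
    using beta_kernel_has_integral[OF assms(1,2)] by blast
  have "beta_kernel a b integrable_on {0..v}"
    by (rule integrable_subinterval_real[OF int]) (use assms in auto)
  hence "integral {0..u} (beta_kernel a b) + integral {u..v} (beta_kernel a b)
      = integral {0..v} (beta_kernel a b)"
    by (intro Henstock_Kurzweil_Integration.integral_combine) (use assms in auto)
  moreover have "beta_kernel a b integrable_on {u..v}"
    by (rule integrable_subinterval_real[OF int]) (use assms in auto)
  ultimately show ?thesis
    unfolding incomplete_beta_def by (simp add: has_integral_iff)
qed

lemma continuous_on_incomplete_beta:
  assumes "a > 0" "b > 0"
  shows "continuous_on {0..1} (incomplete_beta a b)"
  unfolding incomplete_beta_def[abs_def]
  by (rule indefinite_integral_continuous_1) (use beta_kernel_has_integral[OF assms] in blast)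

lemma incomplete_beta_deriv:
  assumes "a > 0" "b > 0" "0 < x" "x < 1"
  shows "(incomplete_beta a b has_real_derivative beta_kernel a b x) (at x)"
proof -
  have "((\<lambda>u. integral {0..u} (beta_kernel a b)) has_vector_derivative beta_kernel a b x)
      (at x within {0..1})"
  proof (rule integral_has_vector_derivative_continuous_at[where S = "{}", simplified])
    show "continuous (at x within {0..1}) (beta_kernel a b)"
      unfolding beta_kernel_def[abs_def] using assms by (intro continuous_intros) auto
  qed (use assms beta_kernel_has_integral[OF assms(1,2)] in auto)
  moreover have "at x within {0..1} = at x"
    using assms by (intro at_within_interior) auto
  ultimately show ?thesis
    by (simp add: incomplete_beta_def[abs_def] has_real_derivative_iff_has_vector_derivative)
qed

lemma incomplete_beta_strict_mono:
  assumes "a > 0" "b > 0" "0 \<le> x" "x < y" "y \<le> 1"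
  shows "incomplete_beta a b x < incomplete_beta a b y"
proof (rule DERIV_pos_imp_increasing_open[OF \<open>x < y\<close>])
  fix z assume "x < z" "z < y"
  thus "\<exists>d. (incomplete_beta a b has_real_derivative d) (at z) \<and> 0 < d"
    using incomplete_beta_deriv[of a b z] beta_kernel_pos[of z a b] assms by force
next
  show "continuous_on {x..y} (incomplete_beta a b)"
    by (rule continuous_on_subset[OF continuous_on_incomplete_beta]) (use assms in auto)
qed

text \<open>The substitution \<open>x \<mapsto> 1 - x\<close>.\<close>

lemma incomplete_beta_reflect:
  assumes "a > 0" "b > 0" "0 \<le> x" "x \<le> 1"
  shows "incomplete_beta b a (1 - x) = Beta a b - incomplete_beta a b x"
proof -
  have "(beta_kernel a b has_integral incomplete_beta a b 1 - incomplete_beta a b x) {x..1}"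
    using assms by (intro beta_kernel_has_integral_interval) auto
  hence "((\<lambda>t. beta_kernel a b (1 - t)) has_integral
      incomplete_beta a b 1 - incomplete_beta a b x) {0..1 - x}"
    using has_integral_affinity[of "beta_kernel a b" _ x 1 "-1" 1]
    by (auto simp: image_diff_atLeastAtMost algebra_simps)
  hence "(beta_kernel b a has_integral Beta a b - incomplete_beta a b x) {0..1 - x}"
    using beta_kernel_reflect[of a b] assms by (simp add: incomplete_beta_1)
  thus ?thesis
    by (simp add: incomplete_beta_def integral_unique)
qed

section \<open>The median of a beta distribution\<close>

lemma emeasure_beta_distr:
  assumes "a > 0" "b > 0" "A \<in> sets borel"
  shows "emeasure (beta_distr a b) A =
    (\<integral>\<^sup>+ x. ennreal (beta_kernel a b x / Beta a b) * indicator (A \<inter> {0..1}) x \<partial>lborel)"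
proof -
  have "emeasure (beta_distr a b) A =
      (\<integral>\<^sup>+ x. ennreal (beta_density a b x) * indicator A x \<partial>lborel)"
    unfolding beta_distr_def using assms
    by (intro emeasure_density) (auto simp: beta_density_def[abs_def])
  also have "\<dots> = (\<integral>\<^sup>+ x. ennreal (beta_kernel a b x / Beta a b) * indicator (A \<inter> {0..1}) x \<partial>lborel)"
    by (intro nn_integral_cong)
      (auto simp: indicator_def beta_density_def beta_kernel_def Beta_def field_simps)
  finally show ?thesis .
qed

lemma measure_beta_distr_interval:
  assumes "a > 0" "b > 0" "A \<in> sets borel" "A \<inter> {0..1} = {u..v}" "0 \<le> u" "u \<le> v" "v \<le> 1"
  shows "measure (beta_distr a b) A =
    (incomplete_beta a b v - incomplete_beta a b u) / Beta a b"
proof -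
  have B: "Beta a b > 0" using assms by (simp add: Beta_pos_real)
  have "((\<lambda>x. beta_kernel a b x / Beta a b) has_integral
      (incomplete_beta a b v - incomplete_beta a b u) / Beta a b) {u..v}"
    using has_integral_divide[OF beta_kernel_has_integral_interval[of a b u v]] assms by simp
  hence "emeasure (beta_distr a b) A =
      ennreal ((incomplete_beta a b v - incomplete_beta a b u) / Beta a b)"
    unfolding emeasure_beta_distr[OF assms(1-3)] assms(4) using B
    by (intro nn_integral_has_integral_lebesgue') (auto intro!: divide_nonneg_pos)
  moreover have "incomplete_beta a b u \<le> incomplete_beta a b v"
    using incomplete_beta_strict_mono[of a b u v] assms by (cases "u = v") auto
  ultimately show ?thesis
    using B by (intro measure_eq_emeasure_eq_ennreal) (auto intro!: divide_nonneg_pos)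
qed

lemma measure_beta_distr_outside:
  assumes "a > 0" "b > 0" "A \<in> sets borel" "A \<inter> {0..1} = {}"
  shows "measure (beta_distr a b) A = 0"
  using emeasure_beta_distr[OF assms(1-3)] assms(4) by (simp add: measure_def)

text \<open>
  There are no atoms, so the two defining inequalities of a median force equality; outside the
  unit interval one of the two tails has no mass.
\<close>

lemma is_median_beta_distr_iff:
  assumes "a > 0" "b > 0"
  shows "is_median (beta_distr a b) m \<longleftrightarrow>
    m \<in> {0..1} \<and> incomplete_beta a b m = Beta a b / 2"
proof (cases "m \<in> {0..1}")
  case True
  have B: "Beta a b > 0" using assms by (simp add: Beta_pos_real)
  have "measure (beta_distr a b) {..m} = incomplete_beta a b m / Beta a b"
    using measure_beta_distr_interval[of a b "{..m}" 0 m] assms True by auto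
  moreover have "measure (beta_distr a b) {m..} = 1 - incomplete_beta a b m / Beta a b"
    using measure_beta_distr_interval[of a b "{m..}" m 1] assms True B
    by (auto simp: incomplete_beta_1 diff_divide_distrib)
  ultimately have "is_median (beta_distr a b) m \<longleftrightarrow> incomplete_beta a b m / Beta a b = 1 / 2"
    unfolding is_median_def by auto
  thus ?thesis using True B by (auto simp: field_simps)
next
  case False
  hence "m < 0 \<or> m > 1" by auto
  hence "measure (beta_distr a b) {..m} = 0 \<or> measure (beta_distr a b) {m..} = 0"
    using measure_beta_distr_outside[OF assms, of "{..m}"]
      measure_beta_distr_outside[OF assms, of "{m..}"] by fastforce
  thus ?thesis using False by (auto simp: is_median_def)
qed

lemma med_beta_distr_eqI:
  assumes "a > 0" "b > 0" "0 \<le> m" "m \<le> 1" "incomplete_beta a b m = Beta a b / 2"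
  shows "med (beta_distr a b) = m"
  unfolding med_def
proof (rule the_equality)
  show "is_median (beta_distr a b) m"
    using assms by (simp add: is_median_beta_distr_iff)
  fix m' assume "is_median (beta_distr a b) m'"
  thus "m' = m"
    using assms incomplete_beta_strict_mono[of a b m m'] incomplete_beta_strict_mono[of a b m' m]
    by (cases m m' rule: linorder_cases) (auto simp: is_median_beta_distr_iff)
qed

lemma med_beta_distr:
  assumes "a > 0" "b > 0"
  shows "incomplete_beta a b (med (beta_distr a b)) = Beta a b / 2"
    and "0 < med (beta_distr a b)" and "med (beta_distr a b) < 1"
proof -
  have B: "Beta a b > 0" using assms by (simp add: Beta_pos_real)
  have "\<exists>x\<ge>0. x \<le> 1 \<and> incomplete_beta a b x = Beta a b / 2"
    using B assms by (intro IVT' continuous_on_incomplete_beta) (auto simp: incomplete_beta_1)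
  then obtain m where m: "0 \<le> m" "m \<le> 1" "incomplete_beta a b m = Beta a b / 2" by auto
  have eq: "med (beta_distr a b) = m" using med_beta_distr_eqI[OF assms m] .
  show "incomplete_beta a b (med (beta_distr a b)) = Beta a b / 2" using eq m by simp
  have "m \<noteq> 0" "m \<noteq> 1" using m B by (auto simp: incomplete_beta_1 assms)
  thus "0 < med (beta_distr a b)" "med (beta_distr a b) < 1" using m eq by auto
qed

lemma less_med_beta_distrI:
  assumes "a > 0" "b > 0" "x \<le> 1" "incomplete_beta a b x < Beta a b / 2"
  shows "x < med (beta_distr a b)"
  using med_beta_distr[OF assms(1,2)] assms
    incomplete_beta_strict_mono[of a b "med (beta_distr a b)" x]
  by (cases x "med (beta_distr a b)" rule: linorder_cases) auto

lemma med_beta_distr_lessI: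
  assumes "a > 0" "b > 0" "0 \<le> x" "incomplete_beta a b x > Beta a b / 2"
  shows "med (beta_distr a b) < x"
  using med_beta_distr[OF assms(1,2)] assms
    incomplete_beta_strict_mono[of a b x "med (beta_distr a b)"]
  by (cases x "med (beta_distr a b)" rule: linorder_cases) auto

lemma med_beta_distr_reflect:
  assumes "a > 0" "b > 0"
  shows "med (beta_distr b a) = 1 - med (beta_distr a b)"
  using med_beta_distr[OF assms] assms
  by (intro med_beta_distr_eqI) (auto simp: incomplete_beta_reflect Beta_commute)

section \<open>The mode--median--mean inequality\<close>

text \<open>
  The point \<open>m\<close> maximises \<open>x powr p * (1 - x) powr q\<close>, and \<open>p < q\<close> puts it left of \<open>1/2\<close>. The
  logarithm \<open>h t\<close> of the quotient of the two sides vanishes at \<open>t = 0\<close>. Since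
  \<open>p = (p + q) * m\<close> and \<open>q = (p + q) * (1 - m)\<close>, its derivative is
  \<open>2 * (p + q) * (d - c)\<close> with \<open>c = 1 / (1 - t\<^sup>2 / m\<^sup>2)\<close> and
  \<open>d = 1 / (1 - t\<^sup>2 / (1 - m)\<^sup>2)\<close>, which is negative because \<open>m < 1 - m\<close>.
\<close>

lemma powr_product_reflect_less:
  fixes p q t :: real
  assumes "0 < p" "p < q" "m = p / (p + q)" "0 < t" "t < m"
  shows "(m - t) powr p * (1 - (m - t)) powr q < (m + t) powr p * (1 - (m + t)) powr q"
proof -
  define h where "h = (\<lambda>t. p * (ln (m - t) - ln (m + t)) + q * (ln (1 - m + t) - ln (1 - m - t)))"
  have "2 * m < 1" using assms(1,2) unfolding assms(3) by (simp add: divide_simps)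
  hence m: "0 < m" "m < 1 - m" using assms by auto
  have pq: "p = (p + q) * m" "q = (p + q) * (1 - m)" using assms by (auto simp: field_simps)
  have "h t < h 0"
  proof (rule DERIV_neg_imp_decreasing_open[OF \<open>0 < t\<close>])
    fix s assume s: "0 < s" "s < t"
    define c where "c = m\<^sup>2 / (m\<^sup>2 - s\<^sup>2)"
    define d where "d = (1 - m)\<^sup>2 / ((1 - m)\<^sup>2 - s\<^sup>2)"
    have sm: "s < m" using s assms by simp
    have ms: "m\<^sup>2 - s\<^sup>2 > 0" "m\<^sup>2 < (1 - m)\<^sup>2"
      using s sm m by (auto intro!: power_strict_mono)
    have "(h has_real_derivative
        p * (- 1 / (m - s) - 1 / (m + s)) + q * (1 / (1 - m + s) + 1 / (1 - m - s))) (at s)"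
      unfolding h_def using s sm m
      by (auto intro!: derivative_eq_intros simp: divide_inverse)
    moreover have "p * (- 1 / (m - s) - 1 / (m + s)) = - 2 * (p + q) * c"
      using s sm m ms by (subst pq(1)) (simp add: c_def divide_simps, simp add: power2_eq_square algebra_simps)
    moreover have "q * (1 / (1 - m + s) + 1 / (1 - m - s)) = 2 * (p + q) * d"
      using s sm m ms by (subst pq(2)) (simp add: d_def divide_simps, simp add: power2_eq_square algebra_simps)
    moreover have "d < c"
      using s ms unfolding c_def d_def by (simp add: divide_simps) (simp add: algebra_simps)
    hence "2 * (p + q) * d < 2 * (p + q) * c"
      using assms(1,2) by (intro mult_strict_left_mono) auto
    hence "- 2 * (p + q) * c + 2 * (p + q) * d < 0" by linarith
    ultimately show "\<exists>y. (h has_real_derivative y) (at s) \<and> y < 0" by metis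
  next
    show "continuous_on {0..t} h"
      unfolding h_def using assms(4,5) m by (intro continuous_intros) auto
  qed
  hence "h t < 0" by (simp add: h_def)
  hence "exp (p * ln (m - t) + q * ln (1 - (m - t))) < exp (p * ln (m + t) + q * ln (1 - (m + t)))"
    by (simp add: h_def algebra_simps)
  thus ?thesis
    using assms(4,5) m by (simp add: powr_def exp_add)
qed

text \<open>
  The function \<open>D t\<close> of the proof is the mass of \<open>{m - t..m}\<close> minus that of \<open>{m..m + t}\<close>, up
  to normalisation. It decreases because the density is larger at \<open>m + t\<close> than at \<open>m - t\<close>. For
  \<open>a = 1\<close> the density is decreasing, the mode is \<open>0\<close>, and the claim is that the median is
  positive.
\<close>

theorem mode_less_med_beta_distr:
  assumes "1 \<le> a" "a < b"
  shows "(a - 1) / (a + b - 2) < med (beta_distr a b)"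
proof (cases "a = 1")
  case True
  thus ?thesis using med_beta_distr(2)[of a b] assms by simp
next
  case False
  define m where "m = (a - 1) / (a + b - 2)"
  define D where "D = (\<lambda>t. 2 * incomplete_beta a b m - incomplete_beta a b (m - t)
    - incomplete_beta a b (m + t))"
  have ab: "a > 1" "b > 1" "a > 0" "b > 0" using False assms by auto
  have m: "0 < m" "2 * m < 1" using ab assms by (auto simp: m_def field_simps)
  have "D m < D 0"
  proof (rule DERIV_neg_imp_decreasing_open[OF \<open>0 < m\<close>])
    fix t assume t: "0 < t" "t < m"
    have "(D has_real_derivative beta_kernel a b (m - t) - beta_kernel a b (m + t)) (at t)"
      unfolding D_def using t m ab
      by (auto intro!: derivative_eq_intros DERIV_chain2[OF incomplete_beta_deriv[of a b]])
    moreover have "beta_kernel a b (m - t) < beta_kernel a b (m + t)"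
      unfolding beta_kernel_def using t ab assms
      by (intro powr_product_reflect_less) (auto simp: m_def)
    ultimately show "\<exists>y. (D has_real_derivative y) (at t) \<and> y < 0" by force
  next
    show "continuous_on {0..m} D"
      unfolding D_def using m ab
      by (intro continuous_intros continuous_on_compose2[OF continuous_on_incomplete_beta]) auto
  qed
  hence "2 * incomplete_beta a b m < incomplete_beta a b (2 * m)"
    by (simp add: D_def)
  also have "\<dots> < Beta a b"
    using incomplete_beta_strict_mono[of a b "2 * m" 1] m ab by (simp add: incomplete_beta_1)
  finally show ?thesis
    using less_med_beta_distrI[of a b m] ab m by (simp add: m_def)
qed

text \<open>
  The integration by parts behind this inequality is carried out by two monotone functions. For
  \<open>t \<le> m\<close>, \<open>T t\<close> is the mass of \<open>{m - t..m}\<close> minus that of \<open>{m..m + t}\<close>, corrected by a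
  boundary term chosen so that the density cancels in the derivative, leaving
  \<open>(G (m + t) - G (m - t)) / (N * t\<^sup>2) > 0\<close>. As \<open>T\<close> tends to \<open>0\<close> at \<open>0\<close>, it is positive at
  \<open>m\<close>. From there on only the right-hand side grows: \<open>S\<close> is the incomplete beta integral with
  the same kind of correction, and it decreases from \<open>2 * m\<close> to \<open>1\<close>, where the correction
  vanishes. Hence the total mass \<open>S 1\<close> is less than \<open>S (2 * m) < 2 * I m\<close>.
\<close>

theorem med_less_mean_beta_distr:
  assumes "0 < a" "a < b"
  shows "med (beta_distr a b) < a / (a + b)"
proof -
  define N where "N = a + b"
  define m where "m = a / N"
  define I where "I = incomplete_beta a b"
  define G where "G = (\<lambda>x::real. x powr a * (1 - x) powr b)"
  define T where "T = (\<lambda>t. 2 * I m - I (m - t) - I (m + t) - (G (m + t) - G (m - t)) / (N * t))"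
  define S where "S = (\<lambda>x. I x + G x / (N * (x - m)))"
  have N: "N > 0" and b: "b > 0" using assms by (auto simp: N_def)
  have m: "0 < m" "2 * m < 1" using N assms by (auto simp: m_def N_def field_simps)
  have I': "(I has_real_derivative beta_kernel a b x) (at x)" if "0 < x" "x < 1" for x
    unfolding I_def using incomplete_beta_deriv assms that by auto
  have I_cont: "continuous_on {0..1} I"
    unfolding I_def using assms by (intro continuous_on_incomplete_beta) auto
  have G': "(G has_real_derivative N * (m - x) * beta_kernel a b x) (at x)"
    if x: "0 < x" "x < 1" for x
  proof -
    have "x powr a = x * x powr (a - 1)" "(1 - x) powr b = (1 - x) * (1 - x) powr (b - 1)"
      using x by (auto simp: powr_diff)
    moreover have "N * m = a" "N = a + b" using N by (auto simp: m_def N_def)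
    hence "N * (m - x) = a * (1 - x) - b * x" by (simp add: algebra_simps)
    ultimately have "a * x powr (a - 1) * (1 - x) powr b - b * (1 - x) powr (b - 1) * x powr a
        = N * (m - x) * beta_kernel a b x"
      by (simp only: beta_kernel_def) (simp add: algebra_simps)
    moreover have "(G has_real_derivative
        a * x powr (a - 1) * (1 - x) powr b - b * (1 - x) powr (b - 1) * x powr a) (at x)"
      unfolding G_def using x by (auto intro!: derivative_eq_intros)
    ultimately show ?thesis by simp
  qed
  have G_cont: "continuous_on {0..1} G"
    unfolding G_def using assms by (intro continuous_intros continuous_on_powr') auto
  have T': "(T has_real_derivative (G (m + t) - G (m - t)) / (N * t\<^sup>2)) (at t)"
    if t: "0 < t" "t < m" for t
  proof -
    have "(T has_real_derivative beta_kernel a b (m - t) - beta_kernel a b (m + t)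
        - ((N * (m - (m + t)) * beta_kernel a b (m + t) + N * (m - (m - t)) * beta_kernel a b (m - t))
              * (N * t) - (G (m + t) - G (m - t)) * N) / (N * t)\<^sup>2) (at t)"
      unfolding T_def using t m N
      by (auto intro!: derivative_eq_intros DERIV_chain2[OF I'] DERIV_chain2[OF G']
          simp: power2_eq_square)
    also have "beta_kernel a b (m - t) - beta_kernel a b (m + t)
        - ((N * (m - (m + t)) * beta_kernel a b (m + t) + N * (m - (m - t)) * beta_kernel a b (m - t))
              * (N * t) - (G (m + t) - G (m - t)) * N) / (N * t)\<^sup>2
        = (G (m + t) - G (m - t)) / (N * t\<^sup>2)"
      using t N by (simp add: divide_simps) (simp add: power2_eq_square algebra_simps)
    finally show ?thesis .
  qed
  have T_less: "T s < T t" if st: "0 < s" "s < t" "t \<le> m" for s t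
  proof (rule DERIV_pos_imp_increasing_open[OF \<open>s < t\<close>])
    fix u assume u: "s < u" "u < t"
    have "G (m - u) < G (m + u)"
      unfolding G_def using u st assms
      by (intro powr_product_reflect_less) (auto simp: m_def N_def)
    hence "(G (m + u) - G (m - u)) / (N * u\<^sup>2) > 0" using u st N by simp
    thus "\<exists>y. (T has_real_derivative y) (at u) \<and> 0 < y" using T'[of u] u st by force
  next
    show "continuous_on {s..t} T"
      unfolding T_def using st m N
      by (intro continuous_intros continuous_on_compose2[OF I_cont]
          continuous_on_compose2[OF G_cont]) auto
  qed
  \<comment> \<open>The boundary term vanishes at \<open>0\<close> since \<open>G (m + t) - G (m - t)\<close> has derivative
      \<open>2 * G' m = 0\<close> there: its quotient by \<open>t\<close> is a difference quotient.\<close>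
  have T_lim: "(T \<longlongrightarrow> 0) (at_right 0)"
  proof -
    have "((\<lambda>t. G (m + t) - G (m - t)) has_real_derivative 0) (at 0)"
      using m by (auto intro!: derivative_eq_intros DERIV_chain2[OF G'])
    hence "((\<lambda>t. (G (m + t) - G (m - t)) / t) \<longlongrightarrow> 0) (at 0)"
      by (simp add: has_field_derivative_iff)
    hence "((\<lambda>t. (G (m + t) - G (m - t)) / t / N) \<longlongrightarrow> 0 / N) (at 0)"
      by (intro tendsto_intros) (use N in auto)
    moreover have "isCont I m" using I'[of m] m DERIV_isCont by auto
    hence "((\<lambda>t. 2 * I m - I (m - t) - I (m + t)) \<longlongrightarrow> 2 * I m - I (m - 0) - I (m + 0)) (at 0)"
      by (intro tendsto_intros isCont_tendsto_compose[of _ I]) auto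
    ultimately have "((\<lambda>t. 2 * I m - I (m - t) - I (m + t) - (G (m + t) - G (m - t)) / t / N)
        \<longlongrightarrow> 2 * I m - I (m - 0) - I (m + 0) - 0 / N) (at 0)"
      by (rule tendsto_diff[rotated])
    hence "(T \<longlongrightarrow> 0) (at 0)"
      by (simp add: T_def mult.commute)
    thus ?thesis by (rule filterlim_mono) (auto simp: at_le)
  qed
  \<comment> \<open>Comparing with the limit only gives a weak inequality; the intermediate point \<open>m / 2\<close>
      makes it strict.\<close>
  have "0 \<le> T (m / 2)"
  proof (rule tendsto_upperbound[OF T_lim])
    show "\<forall>\<^sub>F t in at_right 0. T t \<le> T (m / 2)"
      unfolding eventually_at_right_field
      using T_less[of _ "m / 2"] m by (intro exI[of _ "m / 2"]) (auto intro: less_imp_le)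
  qed auto
  also have "\<dots> < T m" using m by (intro T_less) auto
  \<comment> \<open>\<open>G 0 = 0\<close> and \<open>I 0 = 0\<close>, so the left half has no boundary term at \<open>t = m\<close>.\<close>
  also have "T m = 2 * I m - S (2 * m)"
    using assms by (simp add: T_def S_def I_def G_def)
  finally have "S (2 * m) < 2 * I m" by simp
  moreover have "S 1 < S (2 * m)"
  proof (rule DERIV_neg_imp_decreasing_open[OF m(2)])
    fix x assume x: "2 * m < x" "x < 1"
    have "(S has_real_derivative beta_kernel a b x + (N * (m - x) * beta_kernel a b x
        * (N * (x - m)) - G x * N) / (N * (x - m))\<^sup>2) (at x)"
      unfolding S_def using x m N
      by (auto intro!: derivative_eq_intros DERIV_chain2[OF I'] DERIV_chain2[OF G']
          simp: power2_eq_square)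
    also have "beta_kernel a b x + (N * (m - x) * beta_kernel a b x
        * (N * (x - m)) - G x * N) / (N * (x - m))\<^sup>2 = - G x / (N * (x - m)\<^sup>2)"
      using x m N by (simp add: divide_simps) (simp add: power2_eq_square algebra_simps)
    finally have "(S has_real_derivative - G x / (N * (x - m)\<^sup>2)) (at x)" .
    moreover have "- G x / (N * (x - m)\<^sup>2) < 0"
      using x m N by (simp add: G_def)
    ultimately show "\<exists>y. (S has_real_derivative y) (at x) \<and> y < 0" by blast
  next
    show "continuous_on {2 * m..1} S"
      unfolding S_def using m N
      by (intro continuous_intros continuous_on_subset[OF I_cont]
          continuous_on_subset[OF G_cont]) auto
  qed
  moreover have "S 1 = Beta a b"
    using assms b by (simp add: S_def I_def G_def incomplete_beta_1)
  ultimately show ?thesis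
    using med_beta_distr_lessI[of a b m] m assms by (simp add: I_def m_def N_def)
qed

section \<open>A first parameter equal to one\<close>

text \<open>Here the distribution function is \<open>1 - (1 - x) powr b\<close>, which can be inverted.\<close>

lemma med_beta_distr_1:
  assumes "b > 0"
  shows "med (beta_distr 1 b) = 1 - (1 / 2) powr (1 / b)"
proof (rule med_beta_distr_eqI)
  define x :: real where "x = 1 - (1 / 2) powr (1 / b)"
  have x: "0 \<le> x" "x \<le> 1" using assms by (auto simp: x_def powr_le1)
  show "0 \<le> 1 - (1 / 2) powr (1 / b)" "1 - (1 / 2) powr (1 / b) \<le> 1" using x by (auto simp: x_def)
  have "(beta_kernel 1 b has_integral - ((1 - x) powr b) / b - - ((1 - 0) powr b) / b) {0..x}"
  proof (rule fundamental_theorem_of_calculus_interior[OF \<open>0 \<le> x\<close>])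
    show "continuous_on {0..x} (\<lambda>t. - ((1 - t) powr b) / b)"
      using x assms by (intro continuous_intros continuous_on_powr') auto
    fix t assume "t \<in> {0<..<x}"
    hence t: "0 < t" "t < 1" using x by auto
    have "((\<lambda>t. - ((1 - t) powr b) / b) has_real_derivative beta_kernel 1 b t) (at t)"
      using t assms by (auto intro!: derivative_eq_intros simp: beta_kernel_def)
    thus "((\<lambda>t. - ((1 - t) powr b) / b) has_vector_derivative beta_kernel 1 b t) (at t)"
      by (simp add: has_real_derivative_iff_has_vector_derivative)
  qed
  moreover have "(1 - x) powr b = 1 / 2" using assms by (simp add: x_def powr_powr)
  moreover have "Beta 1 b = 1 / b"
    using assms Gamma_plus1[of b] by (simp add: Beta_def add.commute nonpos_Ints_def Gamma_eq_zero_iff)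
  ultimately show "incomplete_beta 1 b (1 - (1 / 2) powr (1 / b)) = Beta 1 b / 2"
    unfolding x_def[symmetric] by (simp add: incomplete_beta_def integral_unique)
qed (use assms in auto)


section \<open>Comparison of the plotting positions\<close>

lemma piv_B_interior:
  assumes "1 \<le> i" "i \<le> n"
  shows "0 < piv_B n i" "piv_B n i < 1"
  unfolding piv_B_def using assms by (auto intro!: med_beta_distr)

lemma piv_B_reflect:
  assumes "1 \<le> i" "i \<le> n"
  shows "piv_B n (n + 1 - i) = 1 - piv_B n i"
  using med_beta_distr_reflect[of "real i" "real n + 1 - real i"] assms
  by (simp add: piv_B_def of_nat_diff add.commute)

lemma piv_B_bounds_lower_half:
  assumes "1 \<le> i" "2 * i < n + 1"
  shows "(real i - 1) / (real n - 1) < piv_B n i" and "piv_B n i < piv_W n i"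
  using mode_less_med_beta_distr[of "real i" "real n + 1 - real i"]
    med_less_mean_beta_distr[of "real i" "real n + 1 - real i"] assms
  by (simp_all add: piv_B_def piv_W_def)

text \<open>Reflection of the previous bounds: \<open>n + 1 - i\<close> is an index of the lower half.\<close>

lemma piv_B_bounds_upper_half:
  assumes "i \<le> n" "n + 1 < 2 * i"
  shows "piv_W n i < piv_B n i" and "piv_B n i < (real i - 1) / (real n - 1)"
proof -
  have i: "1 \<le> n + 1 - i" "2 * (n + 1 - i) < n + 1" "1 \<le> i" "n > 1" using assms by auto
  have B: "piv_B n (n + 1 - i) = 1 - piv_B n i"
    using assms i by (intro piv_B_reflect) auto
  have W: "piv_W n (n + 1 - i) = 1 - piv_W n i"
    using assms by (simp add: piv_W_def of_nat_diff field_simps)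
  show "piv_W n i < piv_B n i"
    using piv_B_bounds_lower_half(2)[OF i(1,2)] B W by simp
  have "(real (n + 1 - i) - 1) / (real n - 1) = 1 - (real i - 1) / (real n - 1)"
    using assms i by (simp add: of_nat_diff field_simps)
  thus "piv_B n i < (real i - 1) / (real n - 1)"
    using piv_B_bounds_lower_half(1)[OF i(1,2)] B by simp
qed

text \<open>The two parameters agree, so the median is its own mirror image.\<close>

lemma piv_B_centre:
  assumes "2 * i = n + 1"
  shows "piv_B n i = piv_W n i"
proof -
  have "n + 1 - i = i" "1 \<le> i" "i \<le> n" using assms by auto
  hence "piv_B n i = 1 / 2" using piv_B_reflect[of i n] by simp
  moreover have "real n + 1 = 2 * real i" using assms by linarith
  ultimately show ?thesis using \<open>1 \<le> i\<close> by (simp add: piv_W_def)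
qed

lemma mean_minus_mode:
  assumes "n > 1"
  shows "real i / (real n + 1) - (real i - 1) / (real n - 1)
    = (real n + 1 - 2 * real i) / ((real n)\<^sup>2 - 1)"
proof -
  have "(real n)\<^sup>2 - 1 = (real n + 1) * (real n - 1)"
    by (simp add: power2_eq_square algebra_simps)
  thus ?thesis using assms by (simp add: divide_simps) (simp add: algebra_simps)
qed

lemma piv_diff_lower_half:
  assumes "1 \<le> i" "2 * i < n + 1"
  shows "0 < piv_W n i - piv_B n i"
    and "piv_W n i - piv_B n i < \<bar>real n + 1 - 2 * real i\<bar> / ((real n)\<^sup>2 - 1)"
  using piv_B_bounds_lower_half[OF assms] mean_minus_mode[of n i] assms
  by (auto simp: piv_W_def)

lemma piv_diff_upper_half:
  assumes "i \<le> n" "n + 1 < 2 * i"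
  shows "0 < piv_B n i - piv_W n i"
    and "piv_B n i - piv_W n i < \<bar>real n + 1 - 2 * real i\<bar> / ((real n)\<^sup>2 - 1)"
proof -
  have "\<bar>real n + 1 - 2 * real i\<bar> = - (real n + 1 - 2 * real i)" using assms by linarith
  hence "\<bar>real n + 1 - 2 * real i\<bar> / ((real n)\<^sup>2 - 1)
      = - ((real n + 1 - 2 * real i) / ((real n)\<^sup>2 - 1))" by (simp only: minus_divide_left)
  thus "piv_B n i - piv_W n i < \<bar>real n + 1 - 2 * real i\<bar> / ((real n)\<^sup>2 - 1)"
    using piv_B_bounds_upper_half[OF assms] mean_minus_mode[of n i] assms
    by (auto simp: piv_W_def)
qed (use piv_B_bounds_upper_half[OF assms] in auto)

lemma piv_abs_diff:
  assumes "1 \<le> i" "i \<le> n"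
  shows "2 * i \<noteq> n + 1 \<Longrightarrow>
      \<bar>piv_B n i - piv_W n i\<bar> < \<bar>real n + 1 - 2 * real i\<bar> / ((real n)\<^sup>2 - 1)"
    and "2 * i = n + 1 \<Longrightarrow> \<bar>piv_B n i - piv_W n i\<bar> = 0"
  using piv_diff_lower_half[of i n] piv_diff_upper_half[of i n] piv_B_centre[of i n] assms
  by (cases "2 * i" "n + 1" rule: linorder_cases; force)+

lemma abs_index_offset:
  assumes "1 \<le> i" "i \<le> n"
  shows "\<bar>real n + 1 - 2 * real i\<bar> \<le> real n - 1"
    and "i \<noteq> 1 \<and> i \<noteq> n \<Longrightarrow> \<bar>real n + 1 - 2 * real i\<bar> < real n - 1"
  using assms by (auto simp: abs_if)

text \<open>
  Division by \<open>k / (N + 1)\<close> cancels the factor \<open>N + 1\<close> of \<open>N\<^sup>2 - 1\<close>. With \<open>k = i\<close> this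
  turns the absolute bound into the bound for the quotient of the positions, and with
  \<open>k = n + 1 - i\<close> into the one for the quotient of their complements. The second alternative of
  the last hypothesis covers the central index, where \<open>c = 0\<close> and no strict inequality is
  possible.
\<close>

lemma relative_error_bounds:
  fixes x k c N :: real
  assumes "N > 1" "k > 0" "0 \<le> c" "c \<le> N - 1"
    and "\<bar>x - k / (N + 1)\<bar> < c / (N\<^sup>2 - 1) \<or> x = k / (N + 1)"
  shows "\<bar>x / (k / (N + 1)) - 1\<bar> < 1 / k"
    and "\<bar>x / (k / (N + 1)) - 1\<bar> \<le> c / (k * (N - 1))"
    and "c / (k * (N - 1)) \<le> 1 / k"
    and "x \<noteq> k / (N + 1) \<Longrightarrow> \<bar>x / (k / (N + 1)) - 1\<bar> < c / (k * (N - 1))"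
    and "c < N - 1 \<Longrightarrow> c / (k * (N - 1)) < 1 / k"
proof -
  define w where "w = k / (N + 1)"
  have w: "w > 0" using assms by (simp add: w_def)
  have rel: "\<bar>x / w - 1\<bar> = \<bar>x - w\<bar> / w"
    using w by (metis abs_divide abs_of_pos diff_divide_distrib divide_self less_irrefl)
  have sq: "N\<^sup>2 - 1 = (N + 1) * (N - 1)" by (simp add: power2_eq_square algebra_simps)
  have scale: "c / (N\<^sup>2 - 1) / w = c / (k * (N - 1))"
    unfolding sq using assms by (simp add: w_def)
  show strict: "\<bar>x / (k / (N + 1)) - 1\<bar> < c / (k * (N - 1))" if "x \<noteq> k / (N + 1)"
    using assms(5) that divide_strict_right_mono[of "\<bar>x - w\<bar>" "c / (N\<^sup>2 - 1)" w] w
    unfolding scale rel w_def[symmetric] by simp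
  show weak: "\<bar>x / (k / (N + 1)) - 1\<bar> \<le> c / (k * (N - 1))"
    using strict assms w by (cases "x = k / (N + 1)") auto
  show le: "c / (k * (N - 1)) \<le> 1 / k" using assms by (simp add: divide_simps)
  show "c / (k * (N - 1)) < 1 / k" if "c < N - 1" using assms that by (simp add: divide_simps)
  show "\<bar>x / (k / (N + 1)) - 1\<bar> < 1 / k"
    using strict le assms w by (cases "x = k / (N + 1)") auto
qed

text \<open>
  The quotient is \<open>(1 - (1/2) powr (1/m)) * (m + 1)\<close>, and
  \<open>1 - exp (- (ln 2) / m)\<close> is asymptotic to \<open>(ln 2) / m\<close>.
\<close>

lemma piv_B_1_over_piv_W_1_tendsto:
  "(\<lambda>m. piv_B m 1 / piv_W m 1) \<longlonglongrightarrow> ln 2"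
proof (rule Lim_transform_eventually)
  show "(\<lambda>m. (1 - (1 / 2) powr (1 / real m)) * (real m + 1)) \<longlonglongrightarrow> ln 2"
    by (real_asymp simp: ln_div)
  show "\<forall>\<^sub>F m in sequentially.
      (1 - (1 / 2) powr (1 / real m)) * (real m + 1) = piv_B m 1 / piv_W m 1"
    using eventually_gt_at_top[of 0]
    by eventually_elim (simp add: piv_B_def piv_W_def med_beta_distr_1)
qed

theorem theorem4p1:
  fixes n :: nat
  assumes "n > 2"
  shows "
    (\<forall>i\<in>{1..n div 2}.
          0 < piv_W n i - piv_B n i \<and>
          piv_W n i - piv_B n i < \<bar>real n + 1 - 2 * real i\<bar> / ((real n)\<^sup>2 - 1)) \<and>
    (\<forall>i\<in>{n div 2 + 1..n}. 2 * i \<noteq> n + 1 \<longrightarrow>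
          0 < piv_B n i - piv_W n i \<and>
          piv_B n i - piv_W n i < \<bar>real n + 1 - 2 * real i\<bar> / ((real n)\<^sup>2 - 1)) \<and>
    (odd n \<longrightarrow> piv_W n ((n + 1) div 2) = piv_B n ((n + 1) div 2)) \<and>
    (\<forall>i\<in>{1..n}. \<bar>piv_W n i - piv_B n i\<bar> < 1 / (real n + 1)) \<and>
    (0 < piv_B n 1 \<and> piv_B n 1 < piv_W n 1 \<and> piv_W n 1 < 1 \<and>
          0 < piv_W n n \<and> piv_W n n < piv_B n n \<and> piv_B n n < 1) \<and>
    (\<forall>i\<in>{2..n div 2}. piv_W n (i - 1) < piv_B n i \<and> piv_B n i < piv_W n i) \<and>
    (\<forall>i\<in>{n div 2 + 1..n - 1}.
          piv_B n (i - 1) < piv_W n i \<and> piv_W n i \<le> piv_B n i \<and>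
          (2 * i \<noteq> n + 1 \<longrightarrow> piv_W n i < piv_B n i)) \<and>
    (\<forall>i\<in>{1..n}.
          \<bar>piv_B n i / piv_W n i - 1\<bar> < 1 / real i \<and>
          \<bar>piv_B n i / piv_W n i - 1\<bar>
            \<le> \<bar>real n + 1 - 2 * real i\<bar> / (real i * (real n - 1)) \<and>
          \<bar>real n + 1 - 2 * real i\<bar> / (real i * (real n - 1)) \<le> 1 / real i \<and>
          (2 * i \<noteq> n + 1 \<longrightarrow>
            \<bar>piv_B n i / piv_W n i - 1\<bar>
              < \<bar>real n + 1 - 2 * real i\<bar> / (real i * (real n - 1))) \<and>
          (i \<noteq> 1 \<and> i \<noteq> n \<longrightarrow>
            \<bar>real n + 1 - 2 * real i\<bar> / (real i * (real n - 1)) < 1 / real i)) \<and>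
    (\<forall>i\<in>{1..n}.
          \<bar>(1 - piv_B n i) / (1 - piv_W n i) - 1\<bar> < 1 / (real n + 1 - real i) \<and>
          \<bar>(1 - piv_B n i) / (1 - piv_W n i) - 1\<bar>
            \<le> \<bar>real n + 1 - 2 * real i\<bar> / ((real n + 1 - real i) * (real n - 1)) \<and>
          \<bar>real n + 1 - 2 * real i\<bar> / ((real n + 1 - real i) * (real n - 1))
            \<le> 1 / (real n + 1 - real i) \<and>
          (2 * i \<noteq> n + 1 \<longrightarrow>
            \<bar>(1 - piv_B n i) / (1 - piv_W n i) - 1\<bar>
              < \<bar>real n + 1 - 2 * real i\<bar> / ((real n + 1 - real i) * (real n - 1))) \<and>
          (i \<noteq> 1 \<and> i \<noteq> n \<longrightarrow>
            \<bar>real n + 1 - 2 * real i\<bar> / ((real n + 1 - real i) * (real n - 1))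
              < 1 / (real n + 1 - real i))) \<and>
    ((\<lambda>m. piv_B m 1 / piv_W m 1) \<longlonglongrightarrow> ln 2 \<and>
          (\<lambda>m. (1 - piv_B m m) / (1 - piv_W m m)) \<longlonglongrightarrow> ln 2)"
proof -
  have lower: "0 < piv_W n i - piv_B n i \<and>
      piv_W n i - piv_B n i < \<bar>real n + 1 - 2 * real i\<bar> / ((real n)\<^sup>2 - 1)"
    if "i \<in> {1..n div 2}" for i
    using piv_diff_lower_half[of i n] that by auto
  have upper: "0 < piv_B n i - piv_W n i \<and>
      piv_B n i - piv_W n i < \<bar>real n + 1 - 2 * real i\<bar> / ((real n)\<^sup>2 - 1)"
    if "i \<in> {n div 2 + 1..n}" "2 * i \<noteq> n + 1" for i
  proof -
    have "n + 1 < 2 * i" using that by auto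
    thus ?thesis using piv_diff_upper_half[of i n] that by auto
  qed
  have centre: "piv_W n ((n + 1) div 2) = piv_B n ((n + 1) div 2)" if "odd n"
    using that by (intro piv_B_centre[symmetric]) auto
  have rel_B: "\<bar>piv_B n i - real i / (real n + 1)\<bar>
        < \<bar>real n + 1 - 2 * real i\<bar> / ((real n)\<^sup>2 - 1) \<or> piv_B n i = real i / (real n + 1)"
    if "i \<in> {1..n}" for i
    using piv_abs_diff[of i n] that by (auto simp: piv_W_def)
  have rel_C: "\<bar>(1 - piv_B n i) - (real n + 1 - real i) / (real n + 1)\<bar>
        < \<bar>real n + 1 - 2 * real i\<bar> / ((real n)\<^sup>2 - 1)
      \<or> 1 - piv_B n i = (real n + 1 - real i) / (real n + 1)"
    if "i \<in> {1..n}" for i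
    using rel_B[OF that] by (simp add: diff_divide_distrib abs_minus_commute)
  have ne: "piv_B n i \<noteq> piv_W n i" if "i \<in> {1..n}" "2 * i \<noteq> n + 1" for i
    using piv_diff_lower_half[of i n] piv_diff_upper_half[of i n] that
    by (cases "2 * i" "n + 1" rule: linorder_cases) auto
  have W_compl: "1 - piv_W n i = (real n + 1 - real i) / (real n + 1)" for i
    by (simp add: piv_W_def field_simps)
  have abs_diff: "\<bar>piv_W n i - piv_B n i\<bar> < 1 / (real n + 1)" if i: "i \<in> {1..n}" for i
  proof -
    have "(real n)\<^sup>2 - 1 = (real n + 1) * (real n - 1)"
      by (simp add: power2_eq_square algebra_simps)
    hence "\<bar>real n + 1 - 2 * real i\<bar> / ((real n)\<^sup>2 - 1) \<le> 1 / (real n + 1)"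
      using abs_index_offset(1)[of i n] i assms by (simp add: divide_simps)
    moreover have "\<bar>piv_W n i - piv_B n i\<bar> < \<bar>real n + 1 - 2 * real i\<bar> / ((real n)\<^sup>2 - 1)
        \<or> \<bar>piv_W n i - piv_B n i\<bar> = 0"
      using piv_abs_diff[of i n] i by (auto simp: abs_minus_commute)
    moreover have "0 < 1 / (real n + 1)" by simp
    ultimately show ?thesis by linarith
  qed
  have extremes: "0 < piv_B n 1 \<and> piv_B n 1 < piv_W n 1 \<and> piv_W n 1 < 1 \<and>
      0 < piv_W n n \<and> piv_W n n < piv_B n n \<and> piv_B n n < 1"
    using piv_B_interior[of 1 n] piv_B_interior[of n n] lower[of 1] upper[of n] assms
    by (auto simp: piv_W_def)
  have W_mono: "piv_W n (i - 1) \<le> (real i - 1) / (real n - 1)" if "i \<ge> 1" for i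
    using that assms by (simp add: piv_W_def of_nat_diff frac_le)
  have below: "piv_W n (i - 1) < piv_B n i \<and> piv_B n i < piv_W n i"
    if "i \<in> {2..n div 2}" for i
    using piv_B_bounds_lower_half[of i n] W_mono[of i] that by fastforce
  \<comment> \<open>The index \<open>i - 1\<close> may lie on either side of the centre. Up to the centre
      \<open>piv_B n (i - 1) \<le> piv_W n (i - 1)\<close>; beyond it the mode \<open>(i - 2) / (n - 1)\<close> is an
      upper bound, and it is at most \<open>i / (n + 1)\<close> since \<open>i \<le> n + 1\<close>.\<close>
  have pred: "piv_B n (i - 1) < piv_W n i" if i: "i \<in> {n div 2 + 1..n - 1}" for i
  proof -
    have W: "piv_W n (i - 1) < piv_W n i"
      using i assms by (simp add: piv_W_def divide_strict_right_mono of_nat_diff)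
    have i': "1 \<le> i - 1" "i - 1 \<le> n" using i assms by auto
    show ?thesis
    proof (cases "2 * (i - 1) \<le> n + 1")
      case True
      hence "piv_B n (i - 1) \<le> piv_W n (i - 1)"
        using piv_B_bounds_lower_half(2)[OF i'(1), of n] piv_B_centre[of "i - 1" n] by fastforce
      thus ?thesis using W by simp
    next
      case False
      hence "piv_B n (i - 1) < (real (i - 1) - 1) / (real n - 1)"
        using piv_B_bounds_upper_half(2)[OF i'(2)] by simp
      also have "\<dots> \<le> piv_W n i"
      proof -
        have "(real i - 2) * (real n + 1) \<le> real i * (real n - 1)"
          using i by (simp add: algebra_simps) linarith
        thus ?thesis using i assms by (simp add: piv_W_def of_nat_diff divide_simps)
      qed
      finally show ?thesis .
    qed
  qed
  have above: "piv_W n i \<le> piv_B n i \<and> (2 * i \<noteq> n + 1 \<longrightarrow> piv_W n i < piv_B n i)"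
    if "i \<in> {n div 2 + 1..n - 1}" for i
    using upper[of i] piv_B_centre[of i n] that by force
  \<comment> \<open>Reflection carries the complements at the index \<open>m\<close> to the positions at the
      index \<open>1\<close>.\<close>
  have tail: "(\<lambda>m. (1 - piv_B m m) / (1 - piv_W m m)) \<longlonglongrightarrow> ln 2"
  proof (rule Lim_transform_eventually[OF piv_B_1_over_piv_W_1_tendsto])
    show "\<forall>\<^sub>F m in sequentially. piv_B m 1 / piv_W m 1 = (1 - piv_B m m) / (1 - piv_W m m)"
      using eventually_gt_at_top[of 0]
    proof eventually_elim
      case (elim m)
      have "piv_B m 1 = 1 - piv_B m m" using piv_B_reflect[of m m] elim by simp
      moreover have "piv_W m 1 = 1 - piv_W m m" by (simp add: piv_W_def field_simps)
      ultimately show ?case by simp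
    qed
  qed
  have ratio_B:
    "\<bar>piv_B n i / piv_W n i - 1\<bar> < 1 / real i \<and>
      \<bar>piv_B n i / piv_W n i - 1\<bar>
        \<le> \<bar>real n + 1 - 2 * real i\<bar> / (real i * (real n - 1)) \<and>
      \<bar>real n + 1 - 2 * real i\<bar> / (real i * (real n - 1)) \<le> 1 / real i \<and>
      (2 * i \<noteq> n + 1 \<longrightarrow>
        \<bar>piv_B n i / piv_W n i - 1\<bar>
          < \<bar>real n + 1 - 2 * real i\<bar> / (real i * (real n - 1))) \<and>
      (i \<noteq> 1 \<and> i \<noteq> n \<longrightarrow>
        \<bar>real n + 1 - 2 * real i\<bar> / (real i * (real n - 1)) < 1 / real i)"
    if i: "i \<in> {1..n}" for i
    using relative_error_bounds[OF _ _ _ _ rel_B[OF i]] abs_index_offset[of i n] ne[OF i] i assms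
    by (simp add: piv_W_def)
  have ratio_C:
    "\<bar>(1 - piv_B n i) / (1 - piv_W n i) - 1\<bar> < 1 / (real n + 1 - real i) \<and>
      \<bar>(1 - piv_B n i) / (1 - piv_W n i) - 1\<bar>
        \<le> \<bar>real n + 1 - 2 * real i\<bar> / ((real n + 1 - real i) * (real n - 1)) \<and>
      \<bar>real n + 1 - 2 * real i\<bar> / ((real n + 1 - real i) * (real n - 1))
        \<le> 1 / (real n + 1 - real i) \<and>
      (2 * i \<noteq> n + 1 \<longrightarrow>
        \<bar>(1 - piv_B n i) / (1 - piv_W n i) - 1\<bar>
          < \<bar>real n + 1 - 2 * real i\<bar> / ((real n + 1 - real i) * (real n - 1))) \<and>
      (i \<noteq> 1 \<and> i \<noteq> n \<longrightarrow>
        \<bar>real n + 1 - 2 * real i\<bar> / ((real n + 1 - real i) * (real n - 1))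
          < 1 / (real n + 1 - real i))"
    if i: "i \<in> {1..n}" for i
  proof -
    have "1 - piv_B n i \<noteq> (real n + 1 - real i) / (real n + 1)" if "2 * i \<noteq> n + 1"
      using ne[OF i that] W_compl[of i] by linarith
    thus ?thesis
      using relative_error_bounds[OF _ _ _ _ rel_C[OF i]] abs_index_offset[of i n] i assms
      unfolding W_compl by simp
  qed
  show ?thesis
    by (intro conjI ballI impI)
      (use lower upper centre abs_diff extremes below pred above ratio_B ratio_C tail
        piv_B_1_over_piv_W_1_tendsto in blast)+
qed

end
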